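(* Let $S$ be a commutative unital semiring with zero containing an element of infinite multiplicative order, and let $n$ be a positive integer. The Baxter monoid $\mathrm{baxt}_n$ of rank $n$ admits a faithful representation by upper triangular matrices of size $2n^2-n$ over $S$ (that is, an injective monoid homomorphism $\mathrm{baxt}_n\to\mathrm{UT}_{2n^2-n}(S)$) having block-diagonal structure with largest block of size $n$.
   Context: $[n]=\{1,\dots,n\}$, and $[n]^*$ is the free monoid on $[n]$. $\mathrm{UT}_m(S)$ is the monoid of $m\times m$ upper triangular matrices over the semiring $S$ (entries below the diagonal equal to $0_S$) under matrix multiplication. Consider (possibly empty) rooted binary trees, with children designated left and right, whose vertices are labelled by positive integers. Right strict insertion of a symbol $a$ into a tree $T$: if $T$ is empty, create a vertex labelled $a$; otherwise, with $x$ the label of the root, if $a\le x$ recursively insert $a$ into the left subtree of the root, otherwise recursively insert it into the right subtree. Left strict insertion: the same, except that if $a\ge x$ one recursively inserts $a$ into the right subtree, otherwise into the left subtree. For a word $u$ over the positive integers, $\mathrm{P}_{\mathrm{sylv}}(u)$ is the tree obtained from the empty tree by right strict insertion of the symbols of $u$ from right to left, and $\mathrm{P}_{\mathrm{sylv}^\#}(u)$ is the tree obtained from the empty tree by left strict insertion of the symbols of $u$ from left to right. Put $\mathrm{P}_{\mathrm{baxt}}(u)=(\mathrm{P}_{\mathrm{sylv}^\#}(u),\mathrm{P}_{\mathrm{sylv}}(u))$. The relation $u\equiv_{\mathrm{baxt}}v\iff\mathrm{P}_{\mathrm{baxt}}(u)=\mathrm{P}_{\mathrm{baxt}}(v)$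 is a congruence, and $\mathrm{baxt}_n=[n]^*/{\equiv_{\mathrm{baxt}}}$. *)

theory Defs
  imports "HOL-Library.Tree" "Jordan_Normal_Form.Matrix"
begin

subsection \<open>Binary search trees\<close>

fun right_strict_insert :: "nat \<Rightarrow> nat tree \<Rightarrow> nat tree" where
  "right_strict_insert a Leaf = Node Leaf a Leaf"
| "right_strict_insert a (Node l x r) =
     (if a \<le> x then Node (right_strict_insert a l) x r
      else Node l x (right_strict_insert a r))"

fun left_strict_insert :: "nat \<Rightarrow> nat tree \<Rightarrow> nat tree" where
  "left_strict_insert a Leaf = Node Leaf a Leaf"
| "left_strict_insert a (Node l x r) =
     (if a \<ge> x then Node l x (left_strict_insert a r)
      else Node (left_strict_insert a l) x r)"

text \<open>Words are lists of symbols. Note that \<^const>\<open>foldr\<close> inserts the last symbol of the word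
  first, whereas \<^const>\<open>fold\<close> inserts the first symbol first.\<close>

definition P_sylv :: "nat list \<Rightarrow> nat tree" where
  "P_sylv u = foldr right_strict_insert u Leaf"

definition P_sylv_sharp :: "nat list \<Rightarrow> nat tree" where
  "P_sylv_sharp u = fold left_strict_insert u Leaf"

definition P_baxt :: "nat list \<Rightarrow> nat tree \<times> nat tree" where
  "P_baxt u = (P_sylv_sharp u, P_sylv u)"

subsection \<open>The Baxter monoid\<close>

definition baxt_rel :: "nat \<Rightarrow> (nat list \<times> nat list) set" where
  "baxt_rel n = {(u, v). u \<in> lists {1..n} \<and> v \<in> lists {1..n} \<and> P_baxt u = P_baxt v}"

text \<open>The product of two classes is the class of the concatenation of any two representatives;
  by \<open>baxt_rel_append\<close> below, all the sets in the union are equal.\<close>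

definition baxt :: "nat \<Rightarrow> nat list set monoid" where
  "baxt n =
     \<lparr>carrier = lists {1..n} // baxt_rel n,
      mult = (\<lambda>X Y. \<Union>u\<in>X. \<Union>v\<in>Y. baxt_rel n `` {u @ v}),
      one = baxt_rel n `` {[]}\<rparr>"

lemma equiv_baxt_rel: "equiv (lists {1..n}) (baxt_rel n)"
  by (auto simp: equiv_def refl_on_def sym_def trans_def baxt_rel_def)

fun tree_le :: "nat \<Rightarrow> nat tree \<Rightarrow> nat tree" where
  "tree_le x Leaf = Leaf"
| "tree_le x (Node l y r) = (if y \<le> x then Node l y (tree_le x r) else tree_le x l)"

fun tree_gt :: "nat \<Rightarrow> nat tree \<Rightarrow> nat tree" where
  "tree_gt x Leaf = Leaf"
| "tree_gt x (Node l y r) = (if y > x then Node (tree_gt x l) y r else tree_gt x r)"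

fun tree_lt :: "nat \<Rightarrow> nat tree \<Rightarrow> nat tree" where
  "tree_lt x Leaf = Leaf"
| "tree_lt x (Node l y r) = (if y < x then Node l y (tree_lt x r) else tree_lt x l)"

fun tree_ge :: "nat \<Rightarrow> nat tree \<Rightarrow> nat tree" where
  "tree_ge x Leaf = Leaf"
| "tree_ge x (Node l y r) = (if y \<ge> x then Node (tree_ge x l) y r else tree_ge x r)"

lemma tree_le_insert:
  "tree_le x (right_strict_insert a T) =
     (if a \<le> x then right_strict_insert a (tree_le x T) else tree_le x T)"
  by (induction T) auto

lemma tree_gt_insert:
  "tree_gt x (right_strict_insert a T) =
     (if a > x then right_strict_insert a (tree_gt x T) else tree_gt x T)"
  by (induction T) auto

lemma tree_lt_insert:
  "tree_lt x (left_strict_insert a T) =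
     (if a < x then left_strict_insert a (tree_lt x T) else tree_lt x T)"
  by (induction T) auto

lemma tree_ge_insert:
  "tree_ge x (left_strict_insert a T) =
     (if a \<ge> x then left_strict_insert a (tree_ge x T) else tree_ge x T)"
  by (induction T) auto

lemma P_sylv_filter:
  "P_sylv (filter (\<lambda>a. a \<le> x) u) = tree_le x (P_sylv u)"
  "P_sylv (filter (\<lambda>a. x < a) u) = tree_gt x (P_sylv u)"
  by (induction u) (auto simp: P_sylv_def tree_le_insert tree_gt_insert)

lemma P_sylv_sharp_filter:
  "P_sylv_sharp (filter (\<lambda>a. a < x) u) = tree_lt x (P_sylv_sharp u)"
  "P_sylv_sharp (filter (\<lambda>a. x \<le> a) u) = tree_ge x (P_sylv_sharp u)"
  by (induction u rule: rev_induct) (auto simp: P_sylv_sharp_def tree_lt_insert tree_ge_insert)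

lemma foldr_insert_Node:
  "foldr right_strict_insert u (Node l x r) =
     Node (foldr right_strict_insert (filter (\<lambda>a. a \<le> x) u) l) x
          (foldr right_strict_insert (filter (\<lambda>a. x < a) u) r)"
  by (induction u) auto

lemma fold_insert_Node:
  "fold left_strict_insert u (Node l x r) =
     Node (fold left_strict_insert (filter (\<lambda>a. a < x) u) l) x
          (fold left_strict_insert (filter (\<lambda>a. x \<le> a) u) r)"
  by (induction u rule: rev_induct) auto

lemma foldr_insert_cong:
  "P_sylv u = P_sylv v \<Longrightarrow> foldr right_strict_insert u T = foldr right_strict_insert v T"
proof (induction T arbitrary: u v)
  case Leaf
  then show ?case by (simp add: P_sylv_def)
next
  case (Node l x r)
  then show ?case by (simp add: foldr_insert_Node P_sylv_filter)
qed

lemma fold_insert_cong: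
  "P_sylv_sharp u = P_sylv_sharp v \<Longrightarrow> fold left_strict_insert u T = fold left_strict_insert v T"
proof (induction T arbitrary: u v)
  case Leaf
  then show ?case by (simp add: P_sylv_sharp_def)
next
  case (Node l x r)
  then show ?case by (simp add: fold_insert_Node P_sylv_sharp_filter)
qed

lemma baxt_rel_append:
  assumes "(u, u') \<in> baxt_rel n" and "(v, v') \<in> baxt_rel n"
  shows "(u @ v, u' @ v') \<in> baxt_rel n"
  using assms foldr_insert_cong[of u u'] fold_insert_cong[of v v']
  by (auto simp: baxt_rel_def P_baxt_def P_sylv_def P_sylv_sharp_def)

lemma baxt_mult_class:
  assumes "u \<in> lists {1..n}" and "v \<in> lists {1..n}"
  shows "baxt_rel n `` {u} \<otimes>\<^bsub>baxt n\<^esub> baxt_rel n `` {v} = baxt_rel n `` {u @ v}"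
proof -
  have eq: "baxt_rel n `` {u' @ v'} = baxt_rel n `` {u @ v}"
    if "u' \<in> baxt_rel n `` {u}" "v' \<in> baxt_rel n `` {v}" for u' v'
    using equiv_class_eq[OF equiv_baxt_rel baxt_rel_append] that by blast
  have "u \<in> baxt_rel n `` {u}" "v \<in> baxt_rel n `` {v}"
    using assms by (auto simp: baxt_rel_def)
  then have "(\<Union>u'\<in>baxt_rel n `` {u}. \<Union>v'\<in>baxt_rel n `` {v}. baxt_rel n `` {u' @ v'})
      = baxt_rel n `` {u @ v}"
    using eq by blast
  then show ?thesis
    by (simp add: baxt_def)
qed

lemma monoid_baxt: "monoid (baxt n)"
proof -
  have carr: "carrier (baxt n) = (\<lambda>u. baxt_rel n `` {u}) ` lists {1..n}"
    by (auto simp: baxt_def quotient_def)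
  have one: "\<one>\<^bsub>baxt n\<^esub> = baxt_rel n `` {[]}"
    by (simp add: baxt_def)
  show ?thesis
  proof (rule monoidI)
    fix X Y assume "X \<in> carrier (baxt n)" "Y \<in> carrier (baxt n)"
    then obtain u v where "u \<in> lists {1..n}" "v \<in> lists {1..n}"
        "X = baxt_rel n `` {u}" "Y = baxt_rel n `` {v}"
      unfolding carr by blast
    then have "X \<otimes>\<^bsub>baxt n\<^esub> Y = baxt_rel n `` {u @ v}" "u @ v \<in> lists {1..n}"
      by (simp_all only: baxt_mult_class append_in_lists_conv simp_thms)
    then show "X \<otimes>\<^bsub>baxt n\<^esub> Y \<in> carrier (baxt n)" unfolding carr by blast
  next
    show "\<one>\<^bsub>baxt n\<^esub> \<in> carrier (baxt n)" unfolding carr one by blast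
  next
    fix X Y Z
    assume "X \<in> carrier (baxt n)" "Y \<in> carrier (baxt n)" "Z \<in> carrier (baxt n)"
    then obtain u v w where "u \<in> lists {1..n}" "v \<in> lists {1..n}" "w \<in> lists {1..n}"
        "X = baxt_rel n `` {u}" "Y = baxt_rel n `` {v}" "Z = baxt_rel n `` {w}"
      unfolding carr by blast
    then show "X \<otimes>\<^bsub>baxt n\<^esub> Y \<otimes>\<^bsub>baxt n\<^esub> Z = X \<otimes>\<^bsub>baxt n\<^esub> (Y \<otimes>\<^bsub>baxt n\<^esub> Z)"
      by (simp only: baxt_mult_class append_in_lists_conv append_assoc simp_thms)
  next
    fix X assume "X \<in> carrier (baxt n)"
    then obtain u where u: "u \<in> lists {1..n}" "X = baxt_rel n `` {u}"
      unfolding carr by blast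
    show "\<one>\<^bsub>baxt n\<^esub> \<otimes>\<^bsub>baxt n\<^esub> X = X"
      using baxt_mult_class[of "[]" n u] u by (simp add: one)
    show "X \<otimes>\<^bsub>baxt n\<^esub> \<one>\<^bsub>baxt n\<^esub> = X"
      using baxt_mult_class[of u n "[]"] u by (simp add: one)
  qed
qed

subsection \<open>Upper triangular and block-diagonal matrices\<close>

definition UT :: "nat \<Rightarrow> 's::comm_semiring_1 mat monoid" where
  "UT m = \<lparr>carrier = {A \<in> carrier_mat m m. upper_triangular A}, mult = (*), one = 1\<^sub>m m\<rparr>"

text \<open>The list \<open>ks\<close> gives the sizes of the diagonal blocks, in order.\<close>

definition block_diagonal :: "nat list \<Rightarrow> 's::zero mat \<Rightarrow> bool" where
  "block_diagonal ks A \<longleftrightarrow>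
     (\<exists>Bs. map dim_row Bs = ks \<and> (\<forall>B\<in>set Bs. square_mat B) \<and> A = diag_block_mat Bs)"

lemma monoid_UT: "monoid (UT m :: 's::comm_semiring_1 mat monoid)"
proof (rule monoidI)
  fix A B :: "'s mat"
  assume A: "A \<in> carrier (UT m)" and B: "B \<in> carrier (UT m)"
  have "(A * B) $$ (i, j) = 0" if ij: "i < m" "j < i" for i j
  proof -
    have "(A * B) $$ (i, j) = (\<Sum>k = 0..<m. A $$ (i, k) * B $$ (k, j))"
      using A B ij by (auto simp: UT_def scalar_prod_def)
    also have "\<dots> = 0"
    proof (rule sum.neutral, rule ballI)
      fix k assume k: "k \<in> {0..<m}"
      show "A $$ (i, k) * B $$ (k, j) = 0"
      proof (cases "k < i")
        case True
        then have "A $$ (i, k) = 0" using A ij by (auto simp: UT_def)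
        then show ?thesis by simp
      next
        case False
        then have "B $$ (k, j) = 0" using B ij k by (auto simp: UT_def)
        then show ?thesis by simp
      qed
    qed
    finally show ?thesis .
  qed
  then show "A \<otimes>\<^bsub>UT m\<^esub> B \<in> carrier (UT m)"
    using A B by (auto simp: UT_def)
qed (auto simp: UT_def assoc_mult_mat)

end

theory Submission
  imports Defs
begin

text \<open>
  Both search trees of a word are determined by a few numbers, and each of these numbers can be
  computed by a small upper triangular matrix representation of the free monoid.

  Two letters \<open>b < c\<close> in different relative order can only change \<^const>\<open>P_sylv\<close> if no letter
  of \<open>[b, c)\<close> has been inserted before them, for such a letter sends them to different subtrees.
  Since \<^const>\<open>P_sylv\<close> inserts from right to left, what the tree remembers about \<open>b\<close> and \<open>c\<close>
  is therefore only how many \<open>c\<close> stand to the right of the last letter of \<open>[b, c)\<close>. These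
  numbers for all \<open>b < c\<close>, together with the number of occurrences of each letter, are a complete
  set of invariants for \<^const>\<open>P_sylv\<close> (lemma \<open>P_sylv_eq_iff\<close>). The mirror image of this
  argument, with reading direction and order reversed, shows that \<^const>\<open>P_sylv_sharp\<close> is
  governed by the number of \<open>b\<close> to the left of the first letter of \<open>(b, c]\<close>. Both cases are
  instances of one statement about search trees for an arbitrary linear order, \<open>word_tree_eq_iff\<close>.

  For the matrices, put \<open>D = diag(1, a)\<close> and let \<open>E\<close> have first row \<open>(1, 1)\<close> and second row
  \<open>(0, 0)\<close>. Then \<open>E * E = D * E = E\<close>, while \<open>E * D ^ k\<close> has first row \<open>(1, a ^ k)\<close> and second
  row \<open>(0, 0)\<close>. Sending \<open>c\<close> to \<open>D\<close>, the letters of \<open>[b, c)\<close> to \<open>E\<close> and all other letters to the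
  identity, everything to the left of the last \<open>E\<close> is absorbed and the number of \<open>c\<close> after it
  survives as an exponent. The invariants of \<^const>\<open>P_sylv_sharp\<close> are read off in the same way.
  The only nonzero entries that ever occur are single powers of \<open>a\<close>, and a power of \<open>a\<close>
  determines its exponent by hypothesis.

  The numbers of occurrences are recorded by one diagonal block of size \<open>n\<close>. With two blocks of
  size \<open>2\<close> for each of the \<open>n * (n - 1) div 2\<close> pairs \<open>b < c\<close>, the total size is
  \<open>n + 2 * n * (n - 1) = 2 * n ^ 2 - n\<close>.
\<close>

section \<open>Counting letters up to the first barrier\<close>

primrec count_until :: "'a set \<Rightarrow> 'a \<Rightarrow> 'a list \<Rightarrow> nat" where
  "count_until B c [] = 0"
| "count_until B c (x # u) =
     (if x \<in> B then 0 else (if x = c then 1 else 0) + count_until B c u)"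

lemma count_until_empty: "count_until {} c u = count_list u c"
  by (induction u) auto

lemma count_until_notin: "c \<notin> set u \<Longrightarrow> count_until B c u = 0"
  by (induction u) auto

lemma count_until_cong:
  "B \<inter> set u = C \<inter> set u \<Longrightarrow> count_until B c u = count_until C c u"
  by (induction u) auto

lemma count_until_append:
  "count_until B c (u @ v) =
     (if set u \<inter> B = {} then count_until B c u + count_until B c v else count_until B c u)"
  by (induction u) auto

lemma count_until_filter:
  "count_until B c (filter P u) = (if P c then count_until (B \<inter> {x. P x}) c u else 0)"
  by (induction u) auto

section \<open>Search trees of words\<close>

text \<open>The search tree obtained by inserting a word from left to right, written as a recursion on
  subwords. With \<open>R\<close> as a parameter, the orders \<open>(\<le>)\<close> and \<open>(\<ge>)\<close> give the two insertion rules.\<close>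

fun word_tree :: "('a \<Rightarrow> 'a \<Rightarrow> bool) \<Rightarrow> 'a list \<Rightarrow> 'a tree" where
  "word_tree R [] = Leaf"
| "word_tree R (x # u) =
     Node (word_tree R (filter (\<lambda>b. R b x) u)) x (word_tree R (filter (\<lambda>b. \<not> R b x) u))"

lemma P_sylv_rev_eq_word_tree: "P_sylv (rev u) = word_tree (\<le>) u"
proof (induction u rule: length_induct)
  case (1 u)
  show ?case
  proof (cases u)
    case Nil
    then show ?thesis by (simp add: P_sylv_def)
  next
    case (Cons x w)
    have IH: "P_sylv (filter P (rev w)) = word_tree (\<le>) (filter P w)" for P
      using 1 Cons by (simp add: less_Suc_eq_le flip: rev_filter)
    show ?thesis
      using IH[of "\<lambda>b. b \<le> x"] IH[of "\<lambda>b. x < b"]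
      by (simp add: Cons P_sylv_def foldr_insert_Node not_le)
  qed
qed

text \<open>Left strict insertion puts equal letters into the right subtree, right strict insertion into
  the left one. Hence the mirror image appears here: in it, equal letters are on the left again,
  as demanded by the reflexive relation \<open>(\<ge>)\<close>.\<close>

lemma mirror_P_sylv_sharp_eq_word_tree: "mirror (P_sylv_sharp u) = word_tree (\<ge>) u"
proof (induction u rule: length_induct)
  case (1 u)
  show ?case
  proof (cases u)
    case Nil
    then show ?thesis by (simp add: P_sylv_sharp_def)
  next
    case (Cons x w)
    have IH: "mirror (P_sylv_sharp (filter P w)) = word_tree (\<ge>) (filter P w)" for P
      using 1 Cons by (simp add: less_Suc_eq_le)
    show ?thesis
      using IH[of "\<lambda>b. b < x"] IH[of "\<lambda>b. x \<le> b"]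
      by (simp add: Cons P_sylv_sharp_def fold_insert_Node not_le)
  qed
qed

text \<open>A barrier for \<open>c\<close> is an up-closed subset of the letters below \<open>c\<close>. In a finite alphabet
  these are the intervals \<open>[b, c)\<close>. In contrast to intervals, whose end \<open>b\<close> may get lost, barriers
  remain barriers when only the letters on the same side of a root as \<open>c\<close> are kept. This is what
  an induction over the tree needs.\<close>

definition barrier :: "('a \<Rightarrow> 'a \<Rightarrow> bool) \<Rightarrow> 'a \<Rightarrow> 'a set \<Rightarrow> bool" where
  "barrier R c B \<longleftrightarrow>
     (\<forall>b\<in>B. \<not> R c b) \<and> (\<forall>b\<in>B. \<forall>x. R b x \<longrightarrow> \<not> R c x \<longrightarrow> x \<in> B)"

text \<open>The root of the tree is the first letter, and the counts determine it: if \<open>x\<close> is below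
  \<open>y\<close>, a word that starts with \<open>x\<close> has no \<open>y\<close> before its first letter of \<open>[x, y)\<close>, but a word
  that starts with \<open>y\<close> has one. Once the roots agree, the counts for the words without their first
  letter \<open>x\<close> split into those for the two subtrees: if \<open>c\<close> goes to the left of \<open>x\<close>, so do all
  letters below it, and if \<open>c\<close> goes to the right, a barrier not containing \<open>x\<close> has no letters on
  the left, while one containing \<open>x\<close> counts nothing.\<close>

lemma word_tree_eq_iff:
  assumes R: "reflp R" "transp R" "antisymp R" "totalp R"
  shows "word_tree R u = word_tree R v \<longleftrightarrow>
    (\<forall>c B. barrier R c B \<longrightarrow> count_until B c u = count_until B c v)"
  using R
proof (induction R u arbitrary: v rule: word_tree.induct)
  case (1 R)
  have "v = []" if "\<forall>c. count_until {} c v = 0"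
    using that by (auto simp: count_until_empty count_list_0_iff)
  moreover have "barrier R c {}" for c by (simp add: barrier_def)
  ultimately show ?case by (cases v) auto
next
  case (2 R x u)
  note R = "2.prems"
  have sep: False
    if xy: "R x y" "x \<noteq> y"
      and cnt: "\<forall>c B. barrier R c B \<longrightarrow> count_until B c (x # s) = count_until B c (y # t)"
    for x y s t
  proof -
    let ?B = "{b. R x b \<and> \<not> R y b}"
    have "barrier R y ?B"
      using transpD[OF R(2)] by (auto simp: barrier_def)
    moreover have "x \<in> ?B" "y \<notin> ?B"
      using xy reflpD[OF R(1)] antisympD[OF R(3)] by auto
    ultimately have "count_until ?B y (x # s) = 0" "count_until ?B y (y # t) \<noteq> 0"
      by (simp_all del: mem_Collect_eq)
    then show False using cnt \<open>barrier R y ?B\<close> by metis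
  qed
  show ?case
  proof (cases v)
    case Nil
    have "barrier R x {}" by (simp add: barrier_def)
    moreover have "count_until {} x (x # u) \<noteq> count_until {} x []" by simp
    ultimately show ?thesis unfolding Nil word_tree.simps by (metis tree.distinct(1))
  next
    case (Cons y w)
    show ?thesis
    proof (cases "x = y")
      case False
      then have "\<not> (\<forall>c B. barrier R c B \<longrightarrow> count_until B c (x # u) = count_until B c (y # w))"
        using sep[of x y u w] sep[of y x w u] totalpD[OF R(4), of x y] by metis
      then show ?thesis using False Cons by (simp del: count_until.simps)
    next
      case True
      let ?le = "filter (\<lambda>b. R b x)" and ?gt = "filter (\<lambda>b. \<not> R b x)"
      let ?same = "\<lambda>s t. \<forall>c B. barrier R c B \<longrightarrow> count_until B c s = count_until B c t"
      \<comment> \<open>If \<open>c\<close> belongs to the left subtree, so does every letter of a barrier for \<open>c\<close>.\<close>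
      have below_x: "R b x" if "R c x" "\<not> R c b" for b c
        using that totalpD[OF R(4), of b c] transpD[OF R(2), of b c x] by metis
      have "?same (x # u) (x # w) \<longleftrightarrow> ?same (?le u) (?le w) \<and> ?same (?gt u) (?gt w)"
      proof (intro iffI conjI allI impI)
        fix c B assume same: "?same (x # u) (x # w)" and B: "barrier R c B"
        show "count_until B c (?le u) = count_until B c (?le w)"
        proof (cases "R c x")
          case True
          have "barrier R c (B \<inter> {b. R b x})"
            using B below_x[OF True] by (auto simp: barrier_def)
          then have "count_until (B \<inter> {b. R b x}) c (x # u) =
              count_until (B \<inter> {b. R b x}) c (x # w)"
            using same by blast
          moreover have "x \<notin> B" using B True by (auto simp: barrier_def)
          ultimately show ?thesis
            using True by (simp add: count_until_filter split: if_splits)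
        qed (simp add: count_until_filter)
        show "count_until B c (?gt u) = count_until B c (?gt w)"
        proof (cases "R c x")
          case False
          have "barrier R c (B \<inter> {b. \<not> R b x})"
            using B False transpD[OF R(2)] by (auto simp: barrier_def)
          then have "count_until (B \<inter> {b. \<not> R b x}) c (x # u) =
              count_until (B \<inter> {b. \<not> R b x}) c (x # w)"
            using same by blast
          moreover have "R x x" using reflpD[OF R(1)] .
          ultimately show ?thesis
            using False by (simp add: count_until_filter split: if_splits)
        qed (simp add: count_until_filter)
      next
        fix c B
        assume same: "?same (?le u) (?le w) \<and> ?same (?gt u) (?gt w)" and B: "barrier R c B"
        have "count_until B c u = count_until B c w" if "x \<notin> B"
        proof (cases "R c x")
          case True
          have "B \<inter> {b. R b x} = B"
            using B below_x[OF True] by (auto simp: barrier_def)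
          then show ?thesis
            using same B True by (metis count_until_filter)
        next
          case False
          have "B \<inter> {b. \<not> R b x} = B"
            using B False that unfolding barrier_def by blast
          then show ?thesis
            using same B False by (metis (no_types, lifting) count_until_filter)
        qed
        then show "count_until B c (x # u) = count_until B c (x # w)" by simp
      qed
      then show ?thesis
        using "2.IH"(1)[OF R, of "?le w"] "2.IH"(2)[OF R, of "?gt w"] True Cons by simp
    qed
  qed
qed

text \<open>The left end \<open>b\<close> is the least letter of the barrier, or \<open>c\<close> itself if the barrier
  contains no letter of the alphabet.\<close>

lemma barrier_interval:
  assumes R: "reflp R" "transp R" "antisymp R" "totalp R"
    and X: "finite X" "c \<in> X" and B: "barrier R c B"
  shows "\<exists>b\<in>X. R b c \<and> B \<inter> X = {x. R b x \<and> \<not> R c x} \<inter> X"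
proof (cases "B \<inter> X = {}")
  case True
  then show ?thesis using X reflpD[OF R(1)] by blast
next
  case False
  obtain b where b: "b \<in> B \<inter> X" "\<forall>x\<in>B \<inter> X. x \<noteq> b \<longrightarrow> R b x"
    using Finite_Set.bex_least_element[of "B \<inter> X" R] False X R
    by (metis finite_Int transp_on_subset totalp_on_subset subset_UNIV)
  then have "R b c"
    using B totalpD[OF R(4), of b c] reflpD[OF R(1)] by (metis IntD1 barrier_def)
  moreover have "B \<inter> X = {x. R b x \<and> \<not> R c x} \<inter> X"
  proof (intro subset_antisym subsetI)
    fix x assume "x \<in> B \<inter> X"
    then show "x \<in> {x. R b x \<and> \<not> R c x} \<inter> X"
      using b(2) B reflpD[OF R(1), of b] by (cases "x = b") (auto simp: barrier_def)
  next
    fix x assume "x \<in> {x. R b x \<and> \<not> R c x} \<inter> X"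
    then show "x \<in> B \<inter> X"
      using b(1) B by (auto simp: barrier_def)
  qed
  ultimately show ?thesis using b(1) by blast
qed

lemma word_tree_eq_iff_interval:
  assumes R: "reflp R" "transp R" "antisymp R" "totalp R"
    and X: "finite X" "set u \<subseteq> X" "set v \<subseteq> X"
  shows "word_tree R u = word_tree R v \<longleftrightarrow>
    (\<forall>b\<in>X. \<forall>c\<in>X. R b c \<longrightarrow>
       count_until {x. R b x \<and> \<not> R c x} c u = count_until {x. R b x \<and> \<not> R c x} c v)"
    (is "_ \<longleftrightarrow> ?intervals")
proof -
  have "count_until B c u = count_until B c v" if ints: "?intervals" and bar: "barrier R c B" for c B
  proof (cases "c \<in> X")
    case True
    then obtain b where b: "b \<in> X" "R b c" "B \<inter> X = {x. R b x \<and> \<not> R c x} \<inter> X"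
      using barrier_interval[OF R X(1) _ bar] by blast
    then have "count_until B c w = count_until {x. R b x \<and> \<not> R c x} c w" if "set w \<subseteq> X" for w
      using that by (intro count_until_cong) blast
    then show ?thesis using ints b True X by simp
  next
    case False
    then show ?thesis using X by (metis count_until_notin subsetD)
  qed
  moreover have "barrier R c {x. R b x \<and> \<not> R c x}" for b c
    using transpD[OF R(2)] by (auto simp: barrier_def)
  ultimately show ?thesis unfolding word_tree_eq_iff[OF R] by blast
qed

text \<open>The interval \<open>[c, c)\<close> is empty, so the case \<open>b = c\<close> of \<open>word_tree_eq_iff_interval\<close> counts
  all occurrences of \<open>c\<close>. The following splits off this case.\<close>

lemma ball_atLeastAtMost_last:
  "c \<in> {1..n::nat} \<Longrightarrow> (\<forall>b\<in>{1..c}. P b) \<longleftrightarrow> P c \<and> (\<forall>b\<in>{1..<c}. P b)"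
  by (auto simp: le_less)

lemma P_sylv_eq_iff:
  assumes "set u \<subseteq> {1..n}" "set v \<subseteq> {1..n}"
  shows "P_sylv u = P_sylv v \<longleftrightarrow>
    (\<forall>c\<in>{1..n}. count_list u c = count_list v c) \<and>
    (\<forall>c\<in>{1..n}. \<forall>b\<in>{1..<c}.
      count_until {b..<c} c (rev u) = count_until {b..<c} c (rev v))"
proof -
  have set: "{x. b \<le> x \<and> \<not> c \<le> x} = {b..<c}" for b c :: nat by auto
  have "P_sylv u = P_sylv v \<longleftrightarrow> (\<forall>c\<in>{1..n}. \<forall>b\<in>{1..c}.
      count_until {b..<c} c (rev u) = count_until {b..<c} c (rev v))"
    using assms word_tree_eq_iff_interval[of "(\<le>)" "{1..n}" "rev u" "rev v"]
    unfolding set P_sylv_rev_eq_word_tree[symmetric] by auto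
  also have "\<dots> \<longleftrightarrow> (\<forall>c\<in>{1..n}. count_until {c..<c} c (rev u) = count_until {c..<c} c (rev v)) \<and>
    (\<forall>c\<in>{1..n}. \<forall>b\<in>{1..<c}. count_until {b..<c} c (rev u) = count_until {b..<c} c (rev v))"
    by (simp only: ball_atLeastAtMost_last ball_conj_distrib cong: ball_cong)
  finally show ?thesis by (simp add: count_until_empty)
qed

lemma P_sylv_sharp_eq_iff:
  assumes "set u \<subseteq> {1..n}" "set v \<subseteq> {1..n}"
  shows "P_sylv_sharp u = P_sylv_sharp v \<longleftrightarrow>
    (\<forall>b\<in>{1..n}. count_list u b = count_list v b) \<and>
    (\<forall>c\<in>{1..n}. \<forall>b\<in>{1..<c}.
      count_until {b<..c} b u = count_until {b<..c} b v)"
proof -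
  have set: "{x. c \<ge> x \<and> \<not> b \<ge> x} = {b<..c}" for b c :: nat by auto
  have "mirror s = mirror t \<longleftrightarrow> s = t" for s t :: "nat tree"
    by (metis mirror_mirror)
  then have "P_sylv_sharp u = P_sylv_sharp v \<longleftrightarrow> word_tree (\<ge>) u = word_tree (\<ge>) v"
    by (simp flip: mirror_P_sylv_sharp_eq_word_tree)
  also have "\<dots> \<longleftrightarrow> (\<forall>c\<in>{1..n}. \<forall>b\<in>{1..c}.
      count_until {b<..c} b u = count_until {b<..c} b v)"
    using assms word_tree_eq_iff_interval[of "(\<ge>)" "{1..n}" u v]
    unfolding set by auto
  also have "\<dots> \<longleftrightarrow> (\<forall>b\<in>{1..n}. count_until {b<..b} b u = count_until {b<..b} b v) \<and>
    (\<forall>c\<in>{1..n}. \<forall>b\<in>{1..<c}. count_until {b<..c} b u = count_until {b<..c} b v)"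
    by (simp only: ball_atLeastAtMost_last ball_conj_distrib cong: ball_cong)
  finally show ?thesis by (simp add: count_until_empty)
qed

section \<open>Representations of the free monoid\<close>

definition ut_rep :: "nat \<Rightarrow> (nat list \<Rightarrow> 's::comm_semiring_1 mat) \<Rightarrow> bool" where
  "ut_rep k F \<longleftrightarrow> F [] = 1\<^sub>m k \<and> (\<forall>u. F u \<in> carrier (UT k)) \<and> (\<forall>u v. F (u @ v) = F u * F v)"

text \<open>The summands are representations and not just matrices, since the block sizes must be the
  same for all words.\<close>

definition direct_sum :: "(nat list \<Rightarrow> 's::zero mat) list \<Rightarrow> nat list \<Rightarrow> 's mat" where
  "direct_sum Fs u = diag_block_mat (map (\<lambda>F. F u) Fs)"

lemma direct_sum_Cons:
  "direct_sum (F # Fs) u =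
    four_block_mat (F u) (0\<^sub>m (dim_row (F u)) (dim_col (direct_sum Fs u)))
      (0\<^sub>m (dim_row (direct_sum Fs u)) (dim_col (F u))) (direct_sum Fs u)"
  by (simp add: direct_sum_def Let_def)

lemma ut_rep_direct_sum_Cons:
  fixes F :: "nat list \<Rightarrow> 's::comm_semiring_1 mat"
  assumes "ut_rep k F" "ut_rep l (direct_sum Fs :: _ \<Rightarrow> 's mat)"
  shows "ut_rep (k + l) (direct_sum (F # Fs))"
proof -
  have dims: "F u \<in> carrier_mat k k" "direct_sum Fs u \<in> carrier_mat l l" for u
    using assms by (auto simp: ut_rep_def UT_def)
  have four: "direct_sum (F # Fs) u =
      four_block_mat (F u) (0\<^sub>m k l) (0\<^sub>m l k) (direct_sum Fs u)" for u
    using dims[of u] by (simp add: direct_sum_Cons)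
  have "direct_sum (F # Fs) (u @ v) = direct_sum (F # Fs) u * direct_sum (F # Fs) v" for u v
    using assms dims[of u] dims[of v]
    by (simp add: four ut_rep_def mult_four_block_mat[of _ k k _ l _ l _ _ k _ l])
  moreover have "direct_sum (F # Fs) [] = 1\<^sub>m (k + l)"
    using assms by (simp add: four ut_rep_def)
  moreover have "direct_sum (F # Fs) u \<in> carrier (UT (k + l))" for u
  proof -
    have "upper_triangular (F u)" "upper_triangular (direct_sum Fs u)"
      using assms by (auto simp: ut_rep_def UT_def)
    then show ?thesis
      using dims[of u] by (auto simp: four UT_def upper_triangular_def)
  qed
  ultimately show ?thesis by (simp add: ut_rep_def)
qed

lemma ut_rep_direct_sum:
  fixes Fs :: "(nat list \<Rightarrow> 's::comm_semiring_1 mat) list"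
  assumes "list_all2 ut_rep ks Fs"
  shows "ut_rep (sum_list ks) (direct_sum Fs)"
  using assms
proof induction
  case Nil
  show ?case by (auto simp: ut_rep_def direct_sum_def UT_def)
next
  case (Cons k ks F Fs)
  then show ?case using ut_rep_direct_sum_Cons[of k F] by simp
qed

lemma direct_sum_eq_iff:
  fixes Fs :: "(nat list \<Rightarrow> 's::comm_semiring_1 mat) list"
  assumes "list_all2 ut_rep ks Fs"
  shows "direct_sum Fs u = direct_sum Fs v \<longleftrightarrow> (\<forall>F\<in>set Fs. F u = F v)"
  using assms
proof induction
  case Nil
  show ?case by (simp add: direct_sum_def)
next
  case (Cons k ks F Fs)
  have dims: "F u \<in> carrier_mat k k" "F v \<in> carrier_mat k k"
    "direct_sum Fs u \<in> carrier_mat (sum_list ks) (sum_list ks)"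
    "direct_sum Fs v \<in> carrier_mat (sum_list ks) (sum_list ks)"
    using Cons.hyps ut_rep_direct_sum[OF Cons.hyps(2)] by (auto simp: ut_rep_def UT_def)
  have "F u = F v \<and> direct_sum Fs u = direct_sum Fs v"
    if eq: "direct_sum (F # Fs) u = direct_sum (F # Fs) v"
  proof (intro conjI eq_matI)
    fix i j assume "i < dim_row (F v)" "j < dim_col (F v)"
    then show "F u $$ (i, j) = F v $$ (i, j)"
      using arg_cong[OF eq, of "\<lambda>A. A $$ (i, j)"] dims by (auto simp: direct_sum_Cons)
  next
    fix i j assume "i < dim_row (direct_sum Fs v)" "j < dim_col (direct_sum Fs v)"
    then show "direct_sum Fs u $$ (i, j) = direct_sum Fs v $$ (i, j)"
      using arg_cong[OF eq, of "\<lambda>A. A $$ (k + i, k + j)"] dims by (auto simp: direct_sum_Cons)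
  qed (use dims in auto)
  then show ?case
    using Cons.IH by (auto simp: direct_sum_Cons)
qed

lemma block_diagonal_direct_sum:
  fixes Fs :: "(nat list \<Rightarrow> 's::comm_semiring_1 mat) list"
  assumes "list_all2 ut_rep ks Fs"
  shows "block_diagonal ks (direct_sum Fs u)"
proof -
  have "map dim_row (map (\<lambda>F. F u) Fs) = ks \<and> (\<forall>B\<in>set (map (\<lambda>F. F u) Fs). square_mat B)"
    using assms
  proof induction
    case (Cons k ks F Fs)
    then have "F u \<in> carrier_mat k k" by (simp add: ut_rep_def UT_def)
    with Cons.IH show ?case by simp
  qed simp
  then show ?thesis unfolding block_diagonal_def direct_sum_def by blast
qed

definition content_block :: "'s::comm_semiring_1 \<Rightarrow> nat \<Rightarrow> nat list \<Rightarrow> 's mat" where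
  "content_block a n u = mat n n (\<lambda>(i, j). if i = j then a ^ count_list u (Suc i) else 0)"

lemma ut_rep_content_block:
  fixes a :: "'s::comm_semiring_1"
  shows "ut_rep n (content_block a n)"
proof -
  have "content_block a n (u @ v) = content_block a n u * content_block a n v" for u v
  proof (rule eq_matI)
    fix i j
    assume "i < dim_row (content_block a n u * content_block a n v)"
      "j < dim_col (content_block a n u * content_block a n v)"
    then have ij: "i < n" "j < n" by (auto simp: content_block_def)
    have "(\<Sum>k = 0..<n. (if i = k then p else 0) * (if k = j then f k else 0)) =
        (if i = j then p * f j else 0)" for p :: 's and f
    proof -
      have "(\<Sum>k = 0..<n. (if i = k then p else 0) * (if k = j then f k else 0)) =
          (\<Sum>k = 0..<n. if k = i then (if i = j then p * f j else 0) else 0)"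
        by (rule sum.cong) auto
      then show ?thesis using ij by simp
    qed
    then show "content_block a n (u @ v) $$ (i, j) =
        (content_block a n u * content_block a n v) $$ (i, j)"
      using ij by (simp add: content_block_def scalar_prod_def power_add)
  qed (auto simp: content_block_def)
  then show ?thesis
    by (auto simp: ut_rep_def UT_def content_block_def one_mat_def)
qed

lemma content_block_eq_iff:
  assumes "inj (\<lambda>k::nat. a ^ k)"
  shows "content_block a n u = content_block a n v \<longleftrightarrow>
    (\<forall>c\<in>{1..n}. count_list u c = count_list v c)"
proof
  assume eq: "content_block a n u = content_block a n v"
  have "count_list u (Suc i) = count_list v (Suc i)" if "i < n" for i
    using arg_cong[OF eq, of "\<lambda>A. A $$ (i, i)"] that injD[OF assms]
    by (auto simp: content_block_def)
  then show "\<forall>c\<in>{1..n}. count_list u c = count_list v c"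
    by (metis Suc_le_eq Suc_pred' atLeastAtMost_iff le_zero_eq not_one_le_zero zero_less_iff_neq_zero)
next
  assume "\<forall>c\<in>{1..n}. count_list u c = count_list v c"
  then show "content_block a n u = content_block a n v"
    by (auto simp: content_block_def intro!: eq_matI)
qed

definition tri2 :: "'s::comm_semiring_1 \<Rightarrow> 's \<Rightarrow> 's \<Rightarrow> 's mat" where
  "tri2 p q r = mat_of_rows_list 2 [[p, q], [0, r]]"

lemma tri2_in_UT: "tri2 p q r \<in> carrier (UT 2)"
  by (auto simp: tri2_def UT_def mat_of_rows_list_def numeral_2_eq_2 less_Suc_eq
      intro!: upper_triangularI)

lemma tri2_mult: "tri2 p q r * tri2 p' q' r' = tri2 (p * p') (p * q' + q * r') (r * r')"
  by (rule eq_matI) (auto simp: tri2_def mat_of_rows_list_def numeral_2_eq_2 less_Suc_eq scalar_prod_def)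

lemma tri2_one: "tri2 1 0 1 = 1\<^sub>m 2"
  by (rule eq_matI) (auto simp: tri2_def mat_of_rows_list_def numeral_2_eq_2 less_Suc_eq)

lemma tri2_eq_iff:
  fixes p q r p' q' r' :: "'s::comm_semiring_1"
  shows "tri2 p q r = tri2 p' q' r' \<longleftrightarrow> p = p' \<and> q = q' \<and> r = r'"
proof -
  have "tri2 p q r $$ (0, 0) = p" "tri2 p q r $$ (0, 1) = q" "tri2 p q r $$ (1, 1) = r"
    for p q r :: 's
    by (simp_all add: tri2_def mat_of_rows_list_def)
  then show ?thesis by metis
qed

text \<open>The values of the two kinds of blocks of size \<open>2\<close> on words, with \<open>k\<close> the count. Without a
  letter of \<open>B\<close> the matrix is diagonal and contains \<open>a ^ k\<close>; once a letter of \<open>B\<close> occurs, the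
  power moves to the upper right corner, where it is no longer affected by factors on the right
  (for \<open>left_block\<close>) or on the left (for \<open>right_block\<close>).\<close>

definition left_block :: "'s::comm_semiring_1 \<Rightarrow> 'b set \<Rightarrow> 'b \<Rightarrow> 'b list \<Rightarrow> 's mat" where
  "left_block a B c u =
     (if set u \<inter> B = {} then tri2 (a ^ count_until B c u) 0 1 else tri2 0 (a ^ count_until B c u) 1)"

definition right_block :: "'s::comm_semiring_1 \<Rightarrow> 'b set \<Rightarrow> 'b \<Rightarrow> 'b list \<Rightarrow> 's mat" where
  "right_block a B c u =
     (if set u \<inter> B = {} then tri2 1 0 (a ^ count_until B c (rev u))
      else tri2 1 (a ^ count_until B c (rev u)) 0)"

lemma ut_rep_left_block: "ut_rep 2 (left_block a B c)"
  by (auto simp: ut_rep_def left_block_def tri2_in_UT tri2_mult tri2_one tri2_eq_iff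
      count_until_append power_add Int_Un_distrib2)

lemma ut_rep_right_block: "ut_rep 2 (right_block a B c)"
  by (auto simp: ut_rep_def right_block_def tri2_in_UT tri2_mult tri2_one tri2_eq_iff
      count_until_append power_add Int_Un_distrib2 mult.commute)

text \<open>Words over the same letters either both meet \<open>B\<close> or both avoid it, so their blocks have
  the power of \<open>a\<close> in the same position.\<close>

lemma left_block_eq_iff:
  assumes "inj (\<lambda>k::nat. a ^ k)" "set u = set v"
  shows "left_block a B c u = left_block a B c v \<longleftrightarrow> count_until B c u = count_until B c v"
  using assms by (auto simp: left_block_def tri2_eq_iff inj_eq)

lemma right_block_eq_iff:
  assumes "inj (\<lambda>k::nat. a ^ k)" "set u = set v"
  shows "right_block a B c u = right_block a B c v \<longleftrightarrow>
    count_until B c (rev u) = count_until B c (rev v)"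
  using assms by (auto simp: right_block_def tri2_eq_iff inj_eq)

section \<open>The representation of the Baxter monoid\<close>

definition letter_pairs :: "nat \<Rightarrow> (nat \<times> nat) list" where
  "letter_pairs n = [(b, c). c \<leftarrow> [1..<Suc n], b \<leftarrow> [1..<c]]"

lemma ball_letter_pairs:
  "(\<forall>p\<in>set (letter_pairs n). P p) \<longleftrightarrow> (\<forall>c\<in>{1..n}. \<forall>b\<in>{1..<c}. P (b, c))"
  by (auto simp: letter_pairs_def simp del: upt_Suc)

lemma length_letter_pairs: "2 * length (letter_pairs n) = n * (n - 1)"
proof (induction n)
  case (Suc n)
  have "letter_pairs (Suc n) = letter_pairs n @ [(b, Suc n). b \<leftarrow> [1..<Suc n]]"
    by (simp add: letter_pairs_def)
  with Suc show ?case by (cases n) (auto simp: algebra_simps)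
qed (simp add: letter_pairs_def)

definition baxt_blocks :: "'s::comm_semiring_1 \<Rightarrow> nat \<Rightarrow> (nat list \<Rightarrow> 's mat) list" where
  "baxt_blocks a n =
     content_block a n #
     map (\<lambda>(b, c). right_block a {b..<c} c) (letter_pairs n) @
     map (\<lambda>(b, c). left_block a {b<..c} b) (letter_pairs n)"

definition baxt_sizes :: "nat \<Rightarrow> nat list" where
  "baxt_sizes n = n # replicate (2 * length (letter_pairs n)) 2"

lemma ut_rep_baxt_blocks: "list_all2 ut_rep (baxt_sizes n) (baxt_blocks a n)"
  by (auto simp: baxt_sizes_def baxt_blocks_def list_all2_conv_all_nth nth_Cons nth_append
      ut_rep_content_block ut_rep_left_block ut_rep_right_block
      split: nat.splits prod.splits)

lemma sum_list_baxt_sizes: "sum_list (baxt_sizes n) = 2 * n^2 - n"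
proof -
  have "sum_list (baxt_sizes n) = n + 2 * (n * (n - 1))"
    by (simp add: baxt_sizes_def sum_list_replicate length_letter_pairs)
  then show ?thesis by (cases n) (auto simp: power2_eq_square)
qed

lemma Max_baxt_sizes:
  assumes "n \<ge> 1"
  shows "Max (set (baxt_sizes n)) = n"
proof (rule Max_eqI)
  fix k assume "k \<in> set (baxt_sizes n)"
  then show "k \<le> n"
    using length_letter_pairs[of n] assms by (cases "n = 1") (auto simp: baxt_sizes_def)
qed (auto simp: baxt_sizes_def)

text \<open>This is well-definedness and faithfulness at once. The content block has to be compared
  first: it shows that both words use the same letters, and only then do the blocks of size \<open>2\<close>
  reduce to their counts.\<close>

lemma P_baxt_eq_iff:
  fixes a :: "'s::comm_semiring_1"
  assumes a: "inj (\<lambda>k::nat. a ^ k)" and uv: "u \<in> lists {1..n}" "v \<in> lists {1..n}"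
  shows "P_baxt u = P_baxt v \<longleftrightarrow> direct_sum (baxt_blocks a n) u = direct_sum (baxt_blocks a n) v"
proof -
  have sub: "set u \<subseteq> {1..n}" "set v \<subseteq> {1..n}" using uv by auto
  have set: "set u = set v" if "\<forall>c\<in>{1..n}. count_list u c = count_list v c"
    using that sub by (metis count_list_0_iff subsetD subsetI subset_antisym)
  have "direct_sum (baxt_blocks a n) u = direct_sum (baxt_blocks a n) v \<longleftrightarrow>
    (\<forall>c\<in>{1..n}. count_list u c = count_list v c) \<and>
    (\<forall>c\<in>{1..n}. \<forall>b\<in>{1..<c}. right_block a {b..<c} c u = right_block a {b..<c} c v) \<and>
    (\<forall>c\<in>{1..n}. \<forall>b\<in>{1..<c}. left_block a {b<..c} b u = left_block a {b<..c} b v)"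
    unfolding direct_sum_eq_iff[OF ut_rep_baxt_blocks]
    by (simp add: baxt_blocks_def ball_Un ball_letter_pairs content_block_eq_iff[OF a])
  also have "\<dots> \<longleftrightarrow> P_baxt u = P_baxt v"
    unfolding P_baxt_def prod.inject P_sylv_eq_iff[OF sub] P_sylv_sharp_eq_iff[OF sub]
    by (cases "\<forall>c\<in>{1..n}. count_list u c = count_list v c")
      (auto simp only: left_block_eq_iff[OF a set] right_block_eq_iff[OF a set])
  finally show ?thesis by blast
qed

theorem theorem6p11:
  fixes a :: "'s::comm_semiring_1" and n :: nat
  assumes infinite_order: "inj (\<lambda>k::nat. a ^ k)"
    and "n \<ge> 1"
  shows "\<exists>\<phi> :: nat list set \<Rightarrow> 's mat.
           \<phi> \<in> hom (baxt n) (UT (2 * n^2 - n)) \<and>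
           \<phi> \<one>\<^bsub>baxt n\<^esub> = \<one>\<^bsub>UT (2 * n^2 - n)\<^esub> \<and>
           inj_on \<phi> (carrier (baxt n)) \<and>
           (\<exists>ks. (\<forall>k\<in>set ks. k \<ge> 1) \<and>
                 sum_list ks = 2 * n^2 - n \<and>
                 Max (set ks) = n \<and>
                 (\<forall>x\<in>carrier (baxt n). block_diagonal ks (\<phi> x)))"
proof -
  let ?m = "2 * n^2 - n"
  define \<rho> where "\<rho> = direct_sum (baxt_blocks a n)"
  \<comment> \<open>The value on a class does not depend on the representative, by the fact \<open>\<phi>\<close> below.\<close>
  define \<phi> where "\<phi> X = \<rho> (SOME u. u \<in> X)" for X
  have \<rho>: "ut_rep ?m \<rho>"
    using ut_rep_direct_sum[OF ut_rep_baxt_blocks] by (simp add: \<rho>_def sum_list_baxt_sizes)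
  have eq_iff: "baxt_rel n `` {u} = baxt_rel n `` {v} \<longleftrightarrow> \<rho> u = \<rho> v"
    if "u \<in> lists {1..n}" "v \<in> lists {1..n}" for u v
    using that P_baxt_eq_iff[OF infinite_order that] eq_equiv_class_iff[OF equiv_baxt_rel that]
    by (auto simp: \<rho>_def baxt_rel_def)
  have \<phi>: "\<phi> (baxt_rel n `` {u}) = \<rho> u" if u: "u \<in> lists {1..n}" for u
  proof -
    have "u \<in> baxt_rel n `` {u}" using u by (auto simp: baxt_rel_def)
    then have "(u, SOME v. v \<in> baxt_rel n `` {u}) \<in> baxt_rel n"
      by (metis Image_singleton_iff someI)
    then have "(SOME v. v \<in> baxt_rel n `` {u}) \<in> lists {1..n}"
      "P_baxt u = P_baxt (SOME v. v \<in> baxt_rel n `` {u})"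
      unfolding baxt_rel_def by blast+
    then show ?thesis
      using P_baxt_eq_iff[OF infinite_order u] unfolding \<phi>_def \<rho>_def by metis
  qed
  have carrier: "carrier (baxt n) = (\<lambda>u. baxt_rel n `` {u}) ` lists {1..n}"
    by (auto simp: baxt_def quotient_def)
  have "\<phi> \<in> hom (baxt n) (UT ?m)"
  proof (rule homI)
    fix X assume "X \<in> carrier (baxt n)"
    then obtain u where "u \<in> lists {1..n}" "X = baxt_rel n `` {u}"
      unfolding carrier by blast
    then show "\<phi> X \<in> carrier (UT ?m)"
      using \<rho> \<phi> by (metis ut_rep_def)
  next
    fix X Y assume "X \<in> carrier (baxt n)" "Y \<in> carrier (baxt n)"
    then obtain u v where uv: "u \<in> lists {1..n}" "v \<in> lists {1..n}"
      "X = baxt_rel n `` {u}" "Y = baxt_rel n `` {v}"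
      unfolding carrier by blast
    have "\<phi> (X \<otimes>\<^bsub>baxt n\<^esub> Y) = \<rho> (u @ v)"
      using uv by (simp only: baxt_mult_class \<phi> append_in_lists_conv simp_thms)
    then show "\<phi> (X \<otimes>\<^bsub>baxt n\<^esub> Y) = \<phi> X \<otimes>\<^bsub>UT ?m\<^esub> \<phi> Y"
      using uv \<phi> \<rho> by (simp add: ut_rep_def UT_def)
  qed
  moreover have "\<phi> \<one>\<^bsub>baxt n\<^esub> = \<one>\<^bsub>UT ?m\<^esub>"
    using \<phi>[of "[]"] \<rho> by (simp add: baxt_def UT_def ut_rep_def)
  moreover have "inj_on \<phi> (carrier (baxt n))"
  proof (rule inj_onI)
    fix X Y assume "X \<in> carrier (baxt n)" "Y \<in> carrier (baxt n)" and eq: "\<phi> X = \<phi> Y"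
    then obtain u v where "u \<in> lists {1..n}" "v \<in> lists {1..n}"
      "X = baxt_rel n `` {u}" "Y = baxt_rel n `` {v}"
      unfolding carrier by blast
    with eq show "X = Y" using \<phi> eq_iff by metis
  qed
  moreover have "\<forall>X\<in>carrier (baxt n). block_diagonal (baxt_sizes n) (\<phi> X)"
    using block_diagonal_direct_sum[OF ut_rep_baxt_blocks] \<phi>
    unfolding carrier \<rho>_def by (metis (no_types, lifting) imageE)
  moreover have "\<forall>k\<in>set (baxt_sizes n). k \<ge> 1"
    using assms by (auto simp: baxt_sizes_def)
  ultimately show ?thesis
    using sum_list_baxt_sizes Max_baxt_sizes[OF \<open>n \<ge> 1\<close>] by blast
qed

end
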